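(* Under the standing assumptions A1--A4 (see context), assume that $f$ is convex and let $(u_k)_{k\in\mathbb N}$ be generated by the proximal gradient algorithm (see context) with stepsize bounds $0<L_a\le L_b<\infty$. Suppose that there exists a subsequence $(u_{k_j})_j$ with $u_{k_j}\to\bar u$ strongly in $\mathcal U$ and that $\bar u$ satisfies the quadratic growth property: there are $R,\theta,\eta>0$ with $$\frac\theta2\|u-\bar u\|_{\mathcal U}^2\le J(u)-J(\bar u)\qquad\forall u\in\mathcal U\text{ with }\|u-\bar u\|_{\mathcal U}\le R\text{ and }J(u)\le J(\bar u)+\eta.$$ Then there is a constant $C>0$ such that, with $\mu=\max\left\{\frac12,\,1-\frac{\theta}{4L_b}\right\}<1$, $$r_J(u_{k+1})\le\mu\,r_J(u_k),\qquad \|u_k-\bar u\|_{\mathcal U}\le C\mu^{k/2}$$ for all $k$ large enough.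
   Context: Standing assumptions. (A1) $\mathcal U\cong Y^*$, where $Y$ is a separable Banach space with norm $\|\cdot\|_Y$; $\langle\cdot,\cdot\rangle$ is the pairing between $Y$ and $\mathcal U$, and $\mathcal U$ carries the dual norm $\|u\|_{\mathcal U}=\sup_{\|y\|_Y\le1}\langle y,u\rangle$. (A2) $g:\mathcal U\to[0,\infty]$ is proper, convex and sequentially weak* lower semicontinuous. (A3) $f:\mathcal U\to[0,\infty)$ is sequentially weak* lower semicontinuous on $\operatorname{dom}g$, and there are a neighborhood $\mathcal N$ of $\operatorname{dom}g$ in $\mathcal U$ and a map $\nabla f:\operatorname{dom}g\to Y$ such that $f$ is Gâteaux differentiable on $\mathcal N$ with $f'(u)(\delta u)=\langle\nabla f(u),\delta u\rangle$ for all $u\in\operatorname{dom}g$, $\delta u\in\mathcal U$; moreover there is $L_{\nabla f}\ge0$ with $\|\nabla f(u_1)-\nabla f(u_2)\|_Y\le L_{\nabla f}\|u_1-u_2\|_{\mathcal U}$ for all $u_1,u_2\in\operatorname{dom}g$. (A4) With $J:=f+g$: if $\|u_k\|_{\mathcal U}\to\infty$ then $J(u_k)\to\infty$. The residual is $r_J(u):=J(u)-\min_{v\in\mathcal U}J(v)$ (a global minimizer exists under A1--A4). Algorithm. Fix $u_0\in\operatorname{dom}g$ and $0<L_a\le L_b<\infty$. Put $\mathcal Q_L(v,u):=f(u)+\langle\nabla f(u),v-u\rangle+g(v)+\frac L2\|v-u\|_{\mathcal U}^2$. For each $k\in\mathbb N=\{0,1,\dots\}$ choose $u_{k+1}\in\operatorname{arg\,min}_{v\in\mathcal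 U}\mathcal Q_{L_k}(v,u_k)$, where $L_k$ is such that $L_k\in[L_a,L_b]$ and $J(u_{k+1})\le\mathcal Q_{L_k}(u_{k+1},u_k)$. *)

theory Defs
  imports "HOL-Analysis.Analysis"
begin

(* Predual structure: \<Phi> identifies 'u isometrically with the topological dual of 'y, and the
   pairing \<langle>y, u\<rangle> is \<Phi> u y. The norm of 'y \<Rightarrow>\<^sub>L real is the operator norm, i.e. the dual norm
   (see norm_dual_eq_SUP below). *)

definition isometric_dual ::
    "('u::real_normed_vector \<Rightarrow> ('y::real_normed_vector \<Rightarrow>\<^sub>L real)) \<Rightarrow> bool" where
  "isometric_dual \<Phi> \<longleftrightarrow> linear \<Phi> \<and> bij \<Phi> \<and> (\<forall>u. norm (\<Phi> u) = norm u)"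

lemma norm_dual_eq_SUP:
  fixes \<phi> :: "'y::real_normed_vector \<Rightarrow>\<^sub>L real"
  shows "norm \<phi> = (SUP y\<in>{y. norm y \<le> 1}. \<phi> y)"
proof (rule antisym)
  have bdd: "bdd_above (blinfun_apply \<phi> ` {y. norm y \<le> 1})"
  proof (rule bdd_aboveI2)
    fix y :: 'y assume "y \<in> {y. norm y \<le> 1}"
    then show "\<phi> y \<le> norm \<phi>"
      using norm_blinfun[of \<phi> y] mult_left_mono[of "norm y" 1 "norm \<phi>"] by auto
  qed
  let ?s = "SUP y\<in>{y. norm y \<le> 1}. \<phi> y"
  have up: "\<phi> y \<le> ?s" if "norm y \<le> 1" for y
    using that by (intro cSUP_upper bdd) auto
  have s0: "0 \<le> ?s" using up[of 0] by (simp add: blinfun.zero_right)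
  show "norm \<phi> \<le> ?s"
  proof (rule norm_blinfun_bound[OF s0])
    fix y
    show "norm (\<phi> y) \<le> ?s * norm y"
    proof (cases "y = 0")
      case False
      then have "\<phi> (y /\<^sub>R norm y) \<le> ?s" "\<phi> (- (y /\<^sub>R norm y)) \<le> ?s"
        by (auto intro!: up)
      with False show ?thesis
        by (simp add: blinfun.scaleR_right blinfun.minus_right field_simps abs_le_iff)
    qed (simp add: blinfun.zero_right)
  qed
  show "?s \<le> norm \<phi>"
  proof (rule cSUP_least)
    fix y :: 'y assume "y \<in> {y. norm y \<le> 1}"
    then show "\<phi> y \<le> norm \<phi>"
      using norm_blinfun[of \<phi> y] mult_left_mono[of "norm y" 1 "norm \<phi>"] by auto
  qed (auto intro: exI[of _ 0])
qed

definition weak_star_tendsto ::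
    "('u::real_normed_vector \<Rightarrow> ('y::real_normed_vector \<Rightarrow>\<^sub>L real)) \<Rightarrow> (nat \<Rightarrow> 'u) \<Rightarrow> 'u \<Rightarrow> bool" where
  "weak_star_tendsto \<Phi> x u \<longleftrightarrow> (\<forall>y. (\<lambda>n. \<Phi> (x n) y) \<longlonglongrightarrow> \<Phi> u y)"

definition seq_weak_star_lsc_on ::
    "('u::real_normed_vector \<Rightarrow> ('y::real_normed_vector \<Rightarrow>\<^sub>L real)) \<Rightarrow> 'u set \<Rightarrow> ('u \<Rightarrow> ereal) \<Rightarrow> bool" where
  "seq_weak_star_lsc_on \<Phi> S h \<longleftrightarrow>
     (\<forall>x u. range x \<subseteq> S \<longrightarrow> u \<in> S \<longrightarrow> weak_star_tendsto \<Phi> x u \<longrightarrow> h u \<le> liminf (\<lambda>n. h (x n)))"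

definition eff_dom :: "('u \<Rightarrow> ereal) \<Rightarrow> 'u set" where
  "eff_dom g = {u. g u < \<infinity>}"

(* convex_on is restricted to real-valued functions. For functions with values in [0,\<infinity>], the convention
   0 * \<infinity> = 0 of ereal makes the cases t = 0 and t = 1 trivial. *)
definition convex_ereal :: "('u::real_vector \<Rightarrow> ereal) \<Rightarrow> bool" where
  "convex_ereal g \<longleftrightarrow>
     (\<forall>u v. \<forall>t\<in>{0..1}. g ((1 - t) *\<^sub>R u + t *\<^sub>R v) \<le> ereal (1 - t) * g u + ereal t * g v)"

definition has_gateaux_derivative ::
    "('u::real_normed_vector \<Rightarrow> real) \<Rightarrow> ('u \<Rightarrow> real) \<Rightarrow> 'u \<Rightarrow> bool" where
  "has_gateaux_derivative f D u \<longleftrightarrow>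
     bounded_linear D \<and> (\<forall>h. ((\<lambda>t. (f (u + t *\<^sub>R h) - f u) / t) \<longlongrightarrow> D h) (at 0))"

definition objective :: "('u \<Rightarrow> real) \<Rightarrow> ('u \<Rightarrow> ereal) \<Rightarrow> 'u \<Rightarrow> ereal" where
  "objective f g u = ereal (f u) + g u"

(* The subtrahend is the minimum (not the infimum) of J; Least is unspecified if it is not attained. *)
definition residual :: "('u \<Rightarrow> ereal) \<Rightarrow> 'u \<Rightarrow> ereal" where
  "residual J u = J u - (LEAST m. m \<in> range J)"

definition assumption_A1 ::
    "('u::real_normed_vector \<Rightarrow> ('y::banach \<Rightarrow>\<^sub>L real)) \<Rightarrow> bool" where
  "assumption_A1 \<Phi> \<longleftrightarrow> separable_space (euclidean :: 'y topology) \<and> isometric_dual \<Phi>"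

definition assumption_A2 ::
    "('u::real_normed_vector \<Rightarrow> ('y::banach \<Rightarrow>\<^sub>L real)) \<Rightarrow> ('u \<Rightarrow> ereal) \<Rightarrow> bool" where
  "assumption_A2 \<Phi> g \<longleftrightarrow>
     (\<forall>u. 0 \<le> g u) \<and> eff_dom g \<noteq> {} \<and> convex_ereal g \<and> seq_weak_star_lsc_on \<Phi> UNIV g"

definition assumption_A3 ::
    "('u::real_normed_vector \<Rightarrow> ('y::banach \<Rightarrow>\<^sub>L real)) \<Rightarrow> ('u \<Rightarrow> real) \<Rightarrow> ('u \<Rightarrow> ereal) \<Rightarrow> ('u \<Rightarrow> 'y) \<Rightarrow> bool" where
  "assumption_A3 \<Phi> f g gradf \<longleftrightarrow>
     (\<forall>u. 0 \<le> f u) \<and>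
     seq_weak_star_lsc_on \<Phi> (eff_dom g) (\<lambda>u. ereal (f u)) \<and>
     (\<exists>N. eff_dom g \<subseteq> interior N \<and> (\<forall>u\<in>N. \<exists>D. has_gateaux_derivative f D u)) \<and>
     (\<forall>u\<in>eff_dom g. has_gateaux_derivative f (\<lambda>h. \<Phi> h (gradf u)) u) \<and>
     (\<exists>L\<ge>0. \<forall>u1\<in>eff_dom g. \<forall>u2\<in>eff_dom g. norm (gradf u1 - gradf u2) \<le> L * norm (u1 - u2))"

definition assumption_A4 :: "('u::real_normed_vector \<Rightarrow> ereal) \<Rightarrow> bool" where
  "assumption_A4 J \<longleftrightarrow>
     (\<forall>x :: nat \<Rightarrow> 'u. filterlim (\<lambda>k. norm (x k)) at_top sequentially \<longrightarrow> (\<lambda>k. J (x k)) \<longlonglongrightarrow> \<infinity>)"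

definition prox_model ::
    "('u::real_normed_vector \<Rightarrow> ('y::banach \<Rightarrow>\<^sub>L real)) \<Rightarrow> ('u \<Rightarrow> real) \<Rightarrow> ('u \<Rightarrow> ereal) \<Rightarrow> ('u \<Rightarrow> 'y)
      \<Rightarrow> real \<Rightarrow> 'u \<Rightarrow> 'u \<Rightarrow> ereal" where
  "prox_model \<Phi> f g gradf L v u =
     ereal (f u + \<Phi> (v - u) (gradf u)) + g v + ereal (L / 2 * (norm (v - u))\<^sup>2)"

definition prox_grad_sequence ::
    "('u::real_normed_vector \<Rightarrow> ('y::banach \<Rightarrow>\<^sub>L real)) \<Rightarrow> ('u \<Rightarrow> real) \<Rightarrow> ('u \<Rightarrow> ereal) \<Rightarrow> ('u \<Rightarrow> 'y)
      \<Rightarrow> real \<Rightarrow> real \<Rightarrow> (nat \<Rightarrow> real) \<Rightarrow> (nat \<Rightarrow> 'u) \<Rightarrow> bool" where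
  "prox_grad_sequence \<Phi> f g gradf La Lb L u \<longleftrightarrow>
     u 0 \<in> eff_dom g \<and>
     (\<forall>k. L k \<in> {La..Lb} \<and>
          is_arg_min (\<lambda>v. prox_model \<Phi> f g gradf (L k) v (u k)) (\<lambda>v. True) (u (Suc k)) \<and>
          objective f g (u (Suc k)) \<le> prox_model \<Phi> f g gradf (L k) (u (Suc k)) (u k))"

definition quadratic_growth ::
    "('u::real_normed_vector \<Rightarrow> ereal) \<Rightarrow> 'u \<Rightarrow> real \<Rightarrow> real \<Rightarrow> real \<Rightarrow> bool" where
  "quadratic_growth J ubar R \<theta> \<eta> \<longleftrightarrow>
     (\<forall>u. norm (u - ubar) \<le> R \<longrightarrow> J u \<le> J ubar + ereal \<eta> \<longrightarrow>
          ereal (\<theta> / 2 * (norm (u - ubar))\<^sup>2) \<le> J u - J ubar)"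

end

theory Submission
  imports Defs
begin

text \<open>
  Everything rests on one estimate. The stepsize condition bounds the objective at the new iterate by
  the prox model there, and the iterate minimises this model, so its objective value is at most the
  model value at any point of the segment from \<open>u\<^sub>k\<close> to a point \<open>w\<close>; bounding the
  linearisation of \<open>f\<close> from above by convexity gives, for every \<open>t \<in> [0,1]\<close>,
  \[ J(u_{k+1}) \le (1-t) J(u_k) + t J(w) + \frac{L_b}{2} t^2 \|w - u_k\|^2 \]
  (\<open>prox_step_decrease\<close>).

  With \<open>t = 0\<close> this says that \<open>J(u\<^sub>k)\<close> decreases, to some limit \<open>J\<^sup>*\<close>. Along the convergent
  subsequence \<open>\<parallel>w - u\<^sub>k\<parallel>\<close> stays bounded, so passing to the limit, dividing by \<open>t\<close> and
  letting \<open>t\<close> tend to \<open>0\<close> yields \<open>J\<^sup>* \<le> J(w)\<close> for every \<open>w\<close> (\<open>limit_le_of_segment_estimate\<close>).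
  Since \<open>J\<close> is lower semicontinuous along that subsequence, \<open>J(ubar) \<le> J\<^sup>*\<close>. Hence \<open>ubar\<close> is a
  global minimiser and \<open>J\<^sup>* = min J\<close>; so the minimum is attained and the residual is
  \<open>r\<^sub>J(u) = J(u) - J(ubar)\<close>.

  Quadratic growth is only available near \<open>ubar\<close>, whereas only a subsequence is known to be near
  \<open>ubar\<close>. Convexity closes this gap: on the sphere of radius \<open>R\<close> the objective exceeds the minimum by
  at least \<open>min \<eta> (\<theta> R\<^sup>2 / 2)\<close>, hence so it does outside the ball (\<open>quadratic_growth_traps\<close>).
  Therefore all late iterates lie in the ball and \<open>\<theta>/2 \<parallel>u\<^sub>k - ubar\<parallel>\<^sup>2 \<le> r\<^sub>J(u\<^sub>k)\<close>. Inserting this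
  into the estimate with \<open>w = ubar\<close> gives
  \[ r_J(u_{k+1}) \le \left(1 - t + \frac{L_b}{\theta} t^2\right) r_J(u_k) , \]
  and the best step \<open>t = min 1 (\<theta> / (2 L\<^sub>b))\<close> produces the rate \<open>\<mu>\<close>. Growth turns the decay of the
  residual into the decay of the distance.
\<close>

section \<open>Convexity and the objective\<close>

text \<open>Difference quotients of a convex function along a ray increase with the step length, so their
  limit at \<open>0\<close> is at most the quotient for step \<open>1\<close>.\<close>

lemma convex_above_gateaux_linearization:
  fixes f :: "'u::real_normed_vector \<Rightarrow> real"
  assumes convex: "convex_on UNIV f" and deriv: "has_gateaux_derivative f D u"
  shows "f u + D (v - u) \<le> f v"
proof -
  have lim: "((\<lambda>t. (f (u + t *\<^sub>R (v - u)) - f u) / t) \<longlongrightarrow> D (v - u)) (at_right 0)"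
    using deriv unfolding has_gateaux_derivative_def
    by (meson filterlim_at_split)
  have "\<forall>\<^sub>F t in at_right 0. (f (u + t *\<^sub>R (v - u)) - f u) / t \<le> f v - f u"
    unfolding eventually_at_right_field
  proof (intro exI[of _ 1] conjI allI impI)
    fix t :: real assume t: "0 < t" "t < 1"
    have "f ((1 - t) *\<^sub>R u + t *\<^sub>R v) \<le> (1 - t) * f u + t * f v"
      using t by (intro convex_onD[OF convex]) auto
    moreover have "(1 - t) *\<^sub>R u + t *\<^sub>R v = u + t *\<^sub>R (v - u)"
      by (simp add: algebra_simps)
    ultimately show "(f (u + t *\<^sub>R (v - u)) - f u) / t \<le> f v - f u"
      using t by (simp add: field_simps)
  qed simp
  then have "D (v - u) \<le> f v - f u"
    by (intro tendsto_upperbound[OF lim]) simp_all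
  then show ?thesis by simp
qed

lemma eff_dom_iff_real:
  assumes "0 \<le> g u"
  shows "u \<in> eff_dom g \<longleftrightarrow> (\<exists>a\<ge>0. g u = ereal a)"
  using assms by (cases "g u") (auto simp: eff_dom_def)

lemma convex_ereal_real_bound:
  assumes "convex_ereal h" "h u = ereal a" "h v = ereal b" "0 \<le> t" "t \<le> 1"
  shows "h (u + t *\<^sub>R (v - u)) \<le> ereal ((1 - t) * a + t * b)"
proof -
  have "u + t *\<^sub>R (v - u) = (1 - t) *\<^sub>R u + t *\<^sub>R v"
    by (simp add: algebra_simps)
  moreover have "h ((1 - t) *\<^sub>R u + t *\<^sub>R v) \<le> ereal (1 - t) * h u + ereal t * h v"
    using assms(1,4,5) unfolding convex_ereal_def by auto
  ultimately show ?thesis using assms(2,3) by simp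
qed

lemma convex_ereal_objective:
  fixes f :: "'u::real_vector \<Rightarrow> real" and g :: "'u \<Rightarrow> ereal"
  assumes convex_f: "convex_on UNIV f" and convex_g: "convex_ereal g" and nonneg: "\<And>u. 0 \<le> g u"
  shows "convex_ereal (objective f g)"
  unfolding convex_ereal_def
proof (intro allI ballI)
  fix u v :: 'u and t :: real assume t: "t \<in> {0..1}"
  let ?w = "(1 - t) *\<^sub>R u + t *\<^sub>R v"
  have "ereal (f ?w) + g ?w \<le>
      ereal ((1 - t) * f u + t * f v) + (ereal (1 - t) * g u + ereal t * g v)"
    using t convex_g by (intro add_mono)
      (auto simp: convex_ereal_def intro!: convex_onD[OF convex_f])
  also have "\<dots> = ereal (1 - t) * (ereal (f u) + g u) + ereal t * (ereal (f v) + g v)"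
    using nonneg[of u] nonneg[of v] t
    by (cases "g u"; cases "g v"; cases "t = 0"; cases "t = 1") (auto simp: algebra_simps)
  finally show "objective f g ?w \<le> ereal (1 - t) * objective f g u + ereal t * objective f g v"
    by (simp add: objective_def)
qed

section \<open>One step of the method\<close>

lemma prox_step_decrease:
  fixes \<Phi> :: "'u::real_normed_vector \<Rightarrow> ('y::banach \<Rightarrow>\<^sub>L real)"
  assumes \<Phi>: "linear \<Phi>" and convex_f: "convex_on UNIV f" and convex_g: "convex_ereal g"
    and deriv: "has_gateaux_derivative f (\<lambda>h. \<Phi> h (gradf u)) u"
    and argmin: "is_arg_min (\<lambda>v. prox_model \<Phi> f g gradf L v u) (\<lambda>v. True) u'"
    and decrease: "objective f g u' \<le> prox_model \<Phi> f g gradf L u' u"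
    and L: "L \<le> Lb"
    and gu: "g u = ereal a" and gw: "g w = ereal b" and t: "0 \<le> t" "t \<le> 1"
  shows "objective f g u' \<le>
    ereal ((1 - t) * (f u + a) + t * (f w + b) + Lb / 2 * t\<^sup>2 * (norm (w - u))\<^sup>2)"
proof -
  let ?v = "u + t *\<^sub>R (w - u)"
  have "objective f g u' \<le> prox_model \<Phi> f g gradf L ?v u"
    using argmin decrease by (auto simp: is_arg_min_linorder intro: order_trans)
  also have "\<dots> = ereal (f u + t * \<Phi> (w - u) (gradf u)) + g ?v
      + ereal (L / 2 * t\<^sup>2 * (norm (w - u))\<^sup>2)"
    using \<Phi> by (simp add: prox_model_def linear_cmul blinfun.scaleR_left power_mult_distrib mult.assoc)
  also have "\<dots> \<le> ereal (f u + t * (f w - f u)) + ereal ((1 - t) * a + t * b)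
      + ereal (Lb / 2 * t\<^sup>2 * (norm (w - u))\<^sup>2)"
  proof (intro add_mono)
    have "\<Phi> (w - u) (gradf u) \<le> f w - f u"
      using convex_above_gateaux_linearization[OF convex_f deriv, of w] by simp
    then show "ereal (f u + t * \<Phi> (w - u) (gradf u)) \<le> ereal (f u + t * (f w - f u))"
      using t by (simp add: mult_left_mono)
    show "g ?v \<le> ereal ((1 - t) * a + t * b)"
      by (rule convex_ereal_real_bound[OF convex_g gu gw t])
    show "ereal (L / 2 * t\<^sup>2 * (norm (w - u))\<^sup>2) \<le> ereal (Lb / 2 * t\<^sup>2 * (norm (w - u))\<^sup>2)"
      using L by (simp add: mult_right_mono)
  qed
  finally show ?thesis by (simp add: algebra_simps)
qed

text \<open>The quadratic remainder is of higher order in \<open>t\<close> than the linear gain, so short steps towards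
  a better point would push the values below their limit.\<close>

lemma limit_le_of_segment_estimate:
  fixes a :: "nat \<Rightarrow> real" and s :: "nat \<Rightarrow> nat"
  assumes lim: "a \<longlonglongrightarrow> l" and s: "strict_mono s"
    and est: "\<And>k t. 0 \<le> t \<Longrightarrow> t \<le> 1 \<Longrightarrow> a (Suc (s k)) \<le> (1 - t) * a (s k) + t * b + c * t\<^sup>2"
  shows "l \<le> b"
proof -
  have lim_s: "(\<lambda>k. a (s k)) \<longlonglongrightarrow> l"
    using LIMSEQ_subseq_LIMSEQ[OF lim s] by (simp add: o_def)
  have lim_Suc: "(\<lambda>k. a (Suc (s k))) \<longlonglongrightarrow> l"
    using LIMSEQ_subseq_LIMSEQ[OF LIMSEQ_Suc[OF lim] s] by (simp add: o_def)
  have "l - b \<le> c * t" if t: "0 < t" "t < 1" for t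
  proof -
    have "l \<le> (1 - t) * l + t * b + c * t\<^sup>2"
    proof (rule LIMSEQ_le[OF lim_Suc])
      show "(\<lambda>k. (1 - t) * a (s k) + t * b + c * t\<^sup>2) \<longlonglongrightarrow> (1 - t) * l + t * b + c * t\<^sup>2"
        by (intro tendsto_intros lim_s)
    qed (use t est in auto)
    then have "t * (l - b) \<le> t * (c * t)"
      by (simp add: algebra_simps power2_eq_square)
    then show ?thesis using t by simp
  qed
  then have "\<forall>\<^sub>F t in at_right 0. l - b \<le> c * t"
    unfolding eventually_at_right_field by (intro exI[of _ 1]) auto
  moreover have "((\<lambda>t. c * t) \<longlongrightarrow> c * 0) (at_right 0)"
    by (intro tendsto_intros)
  ultimately have "l - b \<le> c * 0"
    by (intro tendsto_lowerbound[of "\<lambda>t. c * t" _ "at_right (0::real)"]) simp_all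
  then show ?thesis by simp
qed

section \<open>Consequences of quadratic growth\<close>

text \<open>If \<open>u\<close> were outside the ball, the segment to \<open>u\<close> would cross the sphere at a point whose value is
  at most that of \<open>u\<close> and at least \<open>\<theta>/2 R\<^sup>2\<close> above the value at the centre.\<close>

lemma quadratic_growth_traps:
  fixes J :: "'u::real_normed_vector \<Rightarrow> ereal"
  assumes convex: "convex_ereal J" and growth: "quadratic_growth J ubar R \<theta> \<eta>"
    and R: "0 < R" and m: "J ubar = ereal m" and a: "J u = ereal a"
    and min: "m \<le> a" and low: "a - m < \<eta>" "a - m < \<theta> / 2 * R\<^sup>2"
  shows "norm (u - ubar) \<le> R"
proof (rule ccontr)
  assume "\<not> norm (u - ubar) \<le> R"
  then have far: "R < norm (u - ubar)" by simp
  define t where "t = R / norm (u - ubar)"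
  define v where "v = ubar + t *\<^sub>R (u - ubar)"
  have pos: "0 < norm (u - ubar)" using far R by linarith
  then have t: "0 \<le> t" "t \<le> 1" using far R by (simp_all add: t_def divide_le_eq_1)
  have dist: "norm (v - ubar) = R" using pos R by (simp add: v_def t_def)
  have "J v \<le> ereal ((1 - t) * m + t * a)"
    unfolding v_def by (rule convex_ereal_real_bound[OF convex m a t])
  also have "(1 - t) * m + t * a \<le> a"
    using mult_left_mono[of m a "1 - t"] min t by (simp add: algebra_simps)
  finally have Jv: "J v \<le> ereal a" by simp
  also have "\<dots> \<le> J ubar + ereal \<eta>" using low m by simp
  finally have "ereal (\<theta> / 2 * R\<^sup>2) \<le> J v - J ubar"
    using growth dist unfolding quadratic_growth_def by fastforce
  also have "\<dots> \<le> ereal (a - m)"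
    using Jv m by (cases "J v") auto
  finally show False using low by simp
qed

text \<open>The factor \<open>1 - t + Lb / \<theta> * t\<^sup>2\<close> is minimised over \<open>[0,1]\<close> by \<open>t = min 1 (\<theta> / (2 * Lb))\<close>.
  The interior minimum is \<open>1 - \<theta> / (4 * Lb)\<close>; when the full step \<open>t = 1\<close> is best, the factor is
  \<open>Lb / \<theta>\<close>, which is then at most \<open>1/2\<close>.\<close>

lemma optimal_step_factor:
  fixes \<theta> Lb :: real
  assumes "0 < \<theta>" "0 < Lb"
  obtains t where "0 \<le> t" "t \<le> 1" "1 - t + Lb / \<theta> * t\<^sup>2 \<le> max (1 / 2) (1 - \<theta> / (4 * Lb))"
proof (cases "\<theta> \<le> 2 * Lb")
  case True
  have "1 - \<theta> / (2 * Lb) + Lb / \<theta> * (\<theta> / (2 * Lb))\<^sup>2 = 1 - \<theta> / (4 * Lb)"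
    using assms by (simp add: field_simps power2_eq_square)
  with True assms show ?thesis by (intro that[of "\<theta> / (2 * Lb)"]) auto
next
  case False
  then have "Lb / \<theta> \<le> 1 / 2" using assms by (simp add: field_simps)
  then show ?thesis by (intro that[of 1]) (simp_all add: le_max_iff_disj)
qed

lemma geometric_decay_from:
  fixes r :: "nat \<Rightarrow> real"
  assumes step: "\<And>k. K \<le> k \<Longrightarrow> r (Suc k) \<le> \<mu> * r k" and \<mu>: "0 < \<mu>" and k: "K \<le> k"
  shows "r k \<le> r K / \<mu> ^ K * \<mu> ^ k"
  using k
proof (induction k rule: dec_induct)
  case base
  then show ?case using \<mu> by simp
next
  case (step n)
  have "r (Suc n) \<le> \<mu> * (r K / \<mu> ^ K * \<mu> ^ n)"
    using assms(1)[OF step.hyps(1)] mult_left_mono[OF step.IH, of \<mu>] \<mu> by linarith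
  then show ?case by (simp add: algebra_simps)
qed

lemma norm_geometric_bound_of_square:
  fixes d B \<mu> :: real
  assumes "0 < \<mu>" "d\<^sup>2 \<le> B * \<mu> ^ k"
  shows "d \<le> sqrt B * \<mu> powr (real k / 2)"
proof -
  have "\<mu> powr (real k / 2) = sqrt (\<mu> ^ k)"
    using assms(1) by (simp add: powr_half_sqrt[symmetric] powr_powr powr_realpow[symmetric])
  moreover have "d \<le> sqrt (B * \<mu> ^ k)"
    using assms(2) by (rule real_le_rsqrt)
  ultimately show ?thesis by (simp add: real_sqrt_mult)
qed

section \<open>Convergence of the method\<close>

lemma weak_star_tendsto_of_tendsto:
  fixes \<Phi> :: "'u::real_normed_vector \<Rightarrow> ('y::real_normed_vector \<Rightarrow>\<^sub>L real)"
  assumes "isometric_dual \<Phi>" and lim: "x \<longlonglongrightarrow> l"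
  shows "weak_star_tendsto \<Phi> x l"
proof -
  have "bounded_linear \<Phi>"
    using assms(1) unfolding isometric_dual_def
    by (intro bounded_linear_intro[where K = 1]) (auto simp: linear_add linear_cmul)
  then have "(\<lambda>n. \<Phi> (x n)) \<longlonglongrightarrow> \<Phi> l"
    by (rule bounded_linear.tendsto[OF _ lim])
  then show ?thesis
    unfolding weak_star_tendsto_def by (auto intro!: tendsto_intros)
qed

text \<open>Lower semicontinuity of \<open>f\<close> is given only along sequences in the domain of \<open>g\<close> whose limit is in that
  domain too; the lower semicontinuity of \<open>g\<close> provides the latter first.\<close>

lemma objective_limit_le:
  fixes \<Phi> :: "'u::real_normed_vector \<Rightarrow> ('y::real_normed_vector \<Rightarrow>\<^sub>L real)"
  assumes lsc_g: "seq_weak_star_lsc_on \<Phi> UNIV g"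
    and lsc_f: "seq_weak_star_lsc_on \<Phi> (eff_dom g) (\<lambda>u. ereal (f u))"
    and f: "\<And>u. 0 \<le> f u" and g: "\<And>u. 0 \<le> g u"
    and x: "weak_star_tendsto \<Phi> x l" and dom: "range x \<subseteq> eff_dom g"
    and lim: "(\<lambda>n. objective f g (x n)) \<longlonglongrightarrow> ereal c"
  shows "l \<in> eff_dom g" and "objective f g l \<le> ereal c"
proof -
  have liminf: "liminf (\<lambda>n. objective f g (x n)) = ereal c"
    using lim by (intro lim_imp_Liminf) simp_all
  have gl: "g l \<le> liminf (\<lambda>n. g (x n))"
    using lsc_g x unfolding seq_weak_star_lsc_on_def by auto
  also have "\<dots> \<le> liminf (\<lambda>n. objective f g (x n))"
    using f by (intro Liminf_mono) (auto simp: objective_def intro!: always_eventually ereal_le_add_self2)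
  finally show l: "l \<in> eff_dom g"
    using liminf by (auto simp: eff_dom_def)
  have fl: "ereal (f l) \<le> liminf (\<lambda>n. ereal (f (x n)))"
    using lsc_f x dom l unfolding seq_weak_star_lsc_on_def by auto
  have "objective f g l \<le> liminf (\<lambda>n. ereal (f (x n))) + liminf (\<lambda>n. g (x n))"
    unfolding objective_def by (intro add_mono fl gl)
  also have "\<dots> \<le> liminf (\<lambda>n. objective f g (x n))"
    unfolding objective_def using f g
    by (intro ereal_liminf_add_mono) (use fl gl g[of l] in auto)
  finally show "objective f g l \<le> ereal c" using liminf by simp
qed

theorem theorem5p2:
  fixes \<Phi> :: "'u::real_normed_vector \<Rightarrow> ('y::banach \<Rightarrow>\<^sub>L real)"
    and f :: "'u \<Rightarrow> real" and g :: "'u \<Rightarrow> ereal" and gradf :: "'u \<Rightarrow> 'y"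
    and J :: "'u \<Rightarrow> ereal"
    and La Lb :: real and L :: "nat \<Rightarrow> real" and u :: "nat \<Rightarrow> 'u"
    and s :: "nat \<Rightarrow> nat" and ubar :: 'u and R \<theta> \<eta> \<mu> :: real
  assumes J: "J = objective f g"
    and A1: "assumption_A1 \<Phi>"
    and A2: "assumption_A2 \<Phi> g"
    and A3: "assumption_A3 \<Phi> f g gradf"
    and A4: "assumption_A4 J"
    and f_convex: "convex_on UNIV f"
    and step_bounds: "0 < La" "La \<le> Lb"
    and alg: "prox_grad_sequence \<Phi> f g gradf La Lb L u"
    and subseq: "strict_mono s" "(u \<circ> s) \<longlonglongrightarrow> ubar"
    and pos: "R > 0" "\<theta> > 0" "\<eta> > 0"
    and growth: "quadratic_growth J ubar R \<theta> \<eta>"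
    and mu: "\<mu> = max (1 / 2) (1 - \<theta> / (4 * Lb))"
  shows "\<mu> < 1 \<and>
    (\<exists>C>0. \<forall>\<^sub>F k in sequentially.
        residual J (u (Suc k)) \<le> ereal \<mu> * residual J (u k) \<and>
        norm (u k - ubar) \<le> C * \<mu> powr (real k / 2))"
proof -
  have Lb: "0 < Lb" using step_bounds by simp
  have \<Phi>: "isometric_dual \<Phi>" and lin: "linear \<Phi>"
    using A1 by (auto simp: assumption_A1_def isometric_dual_def)
  have g0: "0 \<le> g v" and f0: "0 \<le> f v" for v
    using A2 A3 by (auto simp: assumption_A2_def assumption_A3_def)
  have convex_g: "convex_ereal g" using A2 by (simp add: assumption_A2_def)
  have convex_J: "convex_ereal J"
    unfolding J by (rule convex_ereal_objective[OF f_convex convex_g g0])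

  define j where "j v = real_of_ereal (J v)" for v
  have J_eq: "J v = ereal (j v)" if "v \<in> eff_dom g" for v
    using that by (auto simp: eff_dom_iff_real[of g, OF g0] j_def J objective_def)
  have J_inf: "J v = \<infinity>" if "v \<notin> eff_dom g" for v
    using that by (simp add: eff_dom_def J objective_def)
  have j0: "0 \<le> j v" for v
    using f0[of v] g0[of v] unfolding j_def J objective_def
    by (intro real_of_ereal_pos) simp

  have raw_step: "J (u (Suc k)) \<le>
      ereal ((1 - t) * j (u k) + t * j w + Lb / 2 * t\<^sup>2 * (norm (w - u k))\<^sup>2)"
    if uk: "u k \<in> eff_dom g" and w: "w \<in> eff_dom g" and t: "0 \<le> t" "t \<le> 1" for k w t
  proof -
    obtain a b where a: "g (u k) = ereal a" and b: "g w = ereal b"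
      using uk w by (auto simp: eff_dom_iff_real[of g, OF g0])
    have "has_gateaux_derivative f (\<lambda>h. \<Phi> h (gradf (u k))) (u k)"
      using A3 uk by (simp add: assumption_A3_def)
    then have "objective f g (u (Suc k)) \<le>
        ereal ((1 - t) * (f (u k) + a) + t * (f w + b) + Lb / 2 * t\<^sup>2 * (norm (w - u k))\<^sup>2)"
      using alg
      by (intro prox_step_decrease[OF lin f_convex convex_g, where L = "L k"] a b t)
        (auto simp: prox_grad_sequence_def)
    then show ?thesis using a b by (simp add: j_def J objective_def)
  qed
  have dom: "u k \<in> eff_dom g" for k
  proof (induction k)
    case 0
    then show ?case using alg by (simp add: prox_grad_sequence_def)
  next
    case (Suc k)
    then show ?case using raw_step[of k "u k" 0] J_inf[of "u (Suc k)"]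
      by (cases "u (Suc k) \<in> eff_dom g") auto
  qed
  have step: "j (u (Suc k)) \<le> (1 - t) * j (u k) + t * j w + Lb / 2 * t\<^sup>2 * (norm (w - u k))\<^sup>2"
    if "w \<in> eff_dom g" "0 \<le> t" "t \<le> 1" for k w t
    using raw_step[OF dom that] J_eq[OF dom] by simp

  have "decseq (\<lambda>k. j (u k))"
    using step[OF dom, of 0] by (intro decseq_SucI) simp
  then obtain l where l: "(\<lambda>k. j (u k)) \<longlonglongrightarrow> l"
    using decseq_convergent[of "\<lambda>k. j (u k)" 0] j0 by blast
  have l_le: "l \<le> j w" if w: "w \<in> eff_dom g" for w
  proof -
    obtain M where M: "norm (u (s k)) \<le> M" for k
      using convergent_imp_bounded[OF subseq(2)] by (auto simp: bounded_iff)
    have est: "j (u (Suc (s k))) \<le> (1 - t) * j (u (s k)) + t * j w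
        + Lb / 2 * (norm w + M)\<^sup>2 * t\<^sup>2" if "0 \<le> t" "t \<le> 1" for k t
    proof -
      have "norm (w - u (s k)) \<le> norm w + M"
        using norm_triangle_ineq4[of w "u (s k)"] M[of k] by linarith
      then have "(norm (w - u (s k)))\<^sup>2 \<le> (norm w + M)\<^sup>2"
        by (intro power_mono) auto
      then have "Lb / 2 * t\<^sup>2 * (norm (w - u (s k)))\<^sup>2 \<le> Lb / 2 * t\<^sup>2 * (norm w + M)\<^sup>2"
        using Lb by (intro mult_left_mono) auto
      then show ?thesis using step[OF w that, of "s k"] by (simp add: mult_ac)
    qed
    show ?thesis
      by (rule limit_le_of_segment_estimate[OF l subseq(1) est])
  qed

  have "weak_star_tendsto \<Phi> (u \<circ> s) ubar"
    by (rule weak_star_tendsto_of_tendsto[OF \<Phi> subseq(2)])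
  moreover have "(\<lambda>n. objective f g ((u \<circ> s) n)) \<longlonglongrightarrow> ereal l"
    using LIMSEQ_subseq_LIMSEQ[OF l subseq(1)]
    by (simp add: J[symmetric] J_eq[OF dom] o_def)
  ultimately have ubar: "ubar \<in> eff_dom g" and "objective f g ubar \<le> ereal l"
    using objective_limit_le[of \<Phi> g f "u \<circ> s" ubar l] A2 A3 f0 g0 dom
    by (auto simp: assumption_A2_def assumption_A3_def)
  then have l_eq: "l = j ubar"
    using l_le[OF ubar] J_eq[OF ubar] by (simp add: J)
  have J_min: "J ubar \<le> J v" for v
    using l_le[of v] J_eq[OF ubar] J_eq[of v] J_inf[of v] l_eq by (cases "v \<in> eff_dom g") auto
  have "(LEAST m. m \<in> range J) = J ubar"
    using J_min by (intro Least_equality) auto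
  then have residual_eq: "residual J (u k) = ereal (j (u k) - j ubar)" for k
    by (simp add: residual_def J_eq[OF dom] J_eq[OF ubar])

  have r0: "0 \<le> j (u k) - j ubar" for k using l_le[OF dom] l_eq by simp
  have "(\<lambda>k. j (u k) - j ubar) \<longlonglongrightarrow> 0"
    using tendsto_diff[OF l tendsto_const[of l]] l_eq by simp
  then have "\<forall>\<^sub>F k in sequentially. j (u k) - j ubar < min \<eta> (\<theta> / 2 * R\<^sup>2)"
    by (rule order_tendstoD) (use pos in simp)
  then obtain K where K: "j (u k) - j ubar < min \<eta> (\<theta> / 2 * R\<^sup>2)" if "K \<le> k" for k
    by (auto simp: eventually_sequentially)
  have growth_k: "\<theta> / 2 * (norm (u k - ubar))\<^sup>2 \<le> j (u k) - j ubar" if "K \<le> k" for k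
  proof -
    have "norm (u k - ubar) \<le> R"
      by (rule quadratic_growth_traps[OF convex_J growth pos(1) J_eq[OF ubar] J_eq[OF dom]])
        (use K[OF that] r0[of k] in auto)
    moreover have "J (u k) \<le> J ubar + ereal \<eta>"
      using K[OF that] by (simp add: J_eq[OF dom] J_eq[OF ubar])
    ultimately have "ereal (\<theta> / 2 * (norm (u k - ubar))\<^sup>2) \<le> J (u k) - J ubar"
      using growth unfolding quadratic_growth_def by blast
    then show ?thesis by (simp add: J_eq[OF dom] J_eq[OF ubar])
  qed

  obtain t where t: "0 \<le> t" "t \<le> 1" and factor: "1 - t + Lb / \<theta> * t\<^sup>2 \<le> \<mu>"
    using optimal_step_factor[OF pos(2) Lb] unfolding mu by blast
  have contraction: "j (u (Suc k)) - j ubar \<le> \<mu> * (j (u k) - j ubar)" if "K \<le> k" for k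
  proof -
    have "(norm (u k - ubar))\<^sup>2 \<le> 2 / \<theta> * (j (u k) - j ubar)"
      using growth_k[OF that] pos by (simp add: field_simps)
    then have "Lb / 2 * t\<^sup>2 * (norm (ubar - u k))\<^sup>2 \<le> Lb / 2 * t\<^sup>2 * (2 / \<theta> * (j (u k) - j ubar))"
      using Lb by (intro mult_left_mono) (auto simp: norm_minus_commute)
    then have "j (u (Suc k)) - j ubar \<le> (1 - t + Lb / \<theta> * t\<^sup>2) * (j (u k) - j ubar)"
      using step[OF ubar t, of k] by (simp add: algebra_simps diff_divide_distrib)
    also have "\<dots> \<le> \<mu> * (j (u k) - j ubar)"
      using factor r0 by (rule mult_right_mono)
    finally show ?thesis .
  qed

  have \<mu>: "0 < \<mu>" "\<mu> < 1" using pos Lb unfolding mu by auto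
  define B where "B = 2 / \<theta> * ((j (u K) - j ubar) / \<mu> ^ K)"
  have B: "0 \<le> B" using pos r0[of K] \<mu> by (simp add: B_def)
  have dist: "norm (u k - ubar) \<le> (sqrt B + 1) * \<mu> powr (real k / 2)" if "K \<le> k" for k
  proof -
    have "j (u k) - j ubar \<le> (j (u K) - j ubar) / \<mu> ^ K * \<mu> ^ k"
      by (rule geometric_decay_from[where r = "\<lambda>k. j (u k) - j ubar", OF contraction \<mu>(1) that])
    then have "\<theta> / 2 * (norm (u k - ubar))\<^sup>2 \<le> (j (u K) - j ubar) / \<mu> ^ K * \<mu> ^ k"
      using growth_k[OF that] by linarith
    then have "(norm (u k - ubar))\<^sup>2 \<le> B * \<mu> ^ k"
      using pos \<mu> by (simp add: B_def pos_le_divide_eq algebra_simps)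
    then have "norm (u k - ubar) \<le> sqrt B * \<mu> powr (real k / 2)"
      by (rule norm_geometric_bound_of_square[OF \<mu>(1)])
    then show ?thesis
      using powr_ge_zero[of \<mu> "real k / 2"] unfolding distrib_right by linarith
  qed
  show ?thesis
  proof (intro conjI exI[of _ "sqrt B + 1"])
    show "\<mu> < 1" by (fact \<mu>)
    \<comment> \<open>The summand \<open>1\<close> keeps the constant positive when the residual has already reached \<open>0\<close>.\<close>
    show "0 < sqrt B + 1" using real_sqrt_ge_zero[OF B] by linarith
    show "\<forall>\<^sub>F k in sequentially.
        residual J (u (Suc k)) \<le> ereal \<mu> * residual J (u k) \<and>
        norm (u k - ubar) \<le> (sqrt B + 1) * \<mu> powr (real k / 2)"
      unfolding eventually_sequentially residual_eq using contraction dist by auto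
  qed
qed

end
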